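(* Suppose that, for each $t=1,\dots,T$, the cost function $C_t$ on $X_t$ is given by $$C_t(x)=\begin{cases}c^{(b)}_t x,& x\ge 0,\\ c^{(s)}_t x,& x<0,\end{cases}$$ where $c^{(s)}_t\le c^{(b)}_t$, and that the functions $A_t$ are convex. For each $t$ define $$s^{(b)}_t=\operatorname*{arg\,min}_{s\in[0,E_t]}\bigl[c^{(b)}_t s+A_t(s)+V_t(s)\bigr],\qquad s^{(s)}_t=\operatorname*{arg\,min}_{s\in[0,E_t]}\bigl[c^{(s)}_t s+A_t(s)+V_t(s)\bigr],$$ so that $s^{(b)}_t\le s^{(s)}_t$. Then the optimal policy is given by: for each $t$ and given $s_{t-1}$, take $$x_t=\begin{cases}\min\bigl(s^{(b)}_t-s_{t-1},\,P_{It}\bigr)&\text{if } s_{t-1}<s^{(b)}_t,\\ 0&\text{if } s^{(b)}_t\le s_{t-1}\le s^{(s)}_t,\\ \max\bigl(s^{(s)}_t-s_{t-1},\,-P_{Ot}\bigr)&\text{if } s_{t-1}>s^{(s)}_t;\end{cases}$$ that is, this $x_t$ achieves the minimum in the recursion defining $V_{t-1}(s_{t-1})$.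
   Context: Time periods are $t=1,\dots,T$. A store has capacity $E_t>0$ in period $t$, and input and output rate limits $P_{It},P_{Ot}\ge 0$; put $X_t=\{x\in\mathbb{R}:-P_{Ot}\le x\le P_{It}\}$. The cost of a planned change $x\in X_t$ of the store level in period $t$ is $C_t(x)$. For each $t$, $A_t$ is a given real-valued function of the planned level at the end of period $t$ (the expected additional cost of dealing with random shocks). The functions $V_t$ (minimal expected future cost from the end of period $t$) are defined by $V_T(s)=0$ for all possible levels $s$, and, for $t=T,\dots,1$, $$V_{t-1}(s_{t-1})=\min_{x_t\in X_t,\ s_{t-1}+x_t\in[0,E_t]}\bigl[C_t(x_t)+A_t(s_{t-1}+x_t)+V_t(s_{t-1}+x_t)\bigr].$$ Levels are nonnegative reals. $V_{t-1}(s_{t-1})=+\infty$ if there is no feasible $x_t$, and statements about $s_{t-1}$ refer to those levels with $V_{t-1}(s_{t-1})<\infty$. All displayed minima are assumed to be attained. In case of nonuniqueness, $\arg\min$ denotes any minimiser, with $s^{(b)}_t$ and $s^{(s)}_t$ chosen so that $s^{(b)}_t\le s^{(s)}_t$ (automatic if $c^{(s)}_t<c^{(b)}_t$). *)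

theory Defs
  imports "HOL-Analysis.Analysis"
begin

definition rate_set :: "(nat \<Rightarrow> real) \<Rightarrow> (nat \<Rightarrow> real) \<Rightarrow> nat \<Rightarrow> real set" where
  "rate_set Pin Pout t = {- Pout t .. Pin t}"

definition feasible ::
  "(nat \<Rightarrow> real) \<Rightarrow> (nat \<Rightarrow> real) \<Rightarrow> (nat \<Rightarrow> real) \<Rightarrow> nat \<Rightarrow> real \<Rightarrow> real set" where
  "feasible E Pin Pout t s = {x \<in> rate_set Pin Pout t. s + x \<in> {0 .. E t}}"

definition stage_objective ::
  "(nat \<Rightarrow> real \<Rightarrow> real) \<Rightarrow> (nat \<Rightarrow> real \<Rightarrow> real) \<Rightarrow> (nat \<Rightarrow> real \<Rightarrow> ereal)
    \<Rightarrow> nat \<Rightarrow> real \<Rightarrow> real \<Rightarrow> ereal" where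
  "stage_objective C A V t s x = ereal (C t x + A t (s + x)) + V t (s + x)"

text \<open>
  The backward recursion is written from \<open>t\<close> to \<open>Suc t\<close>, so \<open>value_fn \<dots> t\<close> is $V_t$
  for $t \le T$; values at indices beyond \<open>T\<close> are irrelevant and set to 0. The minimum is
  written as an infimum in \<^typ>\<open>ereal\<close>; it is \<open>\<infinity>\<close> when no change of level is feasible.
  The summand is \<open>stage_objective C A V (Suc t) s x\<close>, unfolded only so that the recursive
  call is fully applied; see \<open>value_fn_step\<close>.
\<close>

function value_fn ::
  "nat \<Rightarrow> (nat \<Rightarrow> real) \<Rightarrow> (nat \<Rightarrow> real) \<Rightarrow> (nat \<Rightarrow> real) \<Rightarrow> (nat \<Rightarrow> real \<Rightarrow> real)
    \<Rightarrow> (nat \<Rightarrow> real \<Rightarrow> real) \<Rightarrow> nat \<Rightarrow> real \<Rightarrow> ereal" where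
  "value_fn T E Pin Pout C A t s =
    (if t < T then
       (INF x \<in> feasible E Pin Pout (Suc t) s.
          ereal (C (Suc t) x + A (Suc t) (s + x)) + value_fn T E Pin Pout C A (Suc t) (s + x))
     else 0)"
  by pat_completeness auto
termination
  by (relation "Wellfounded.measure (\<lambda>(T, E, Pin, Pout, C, A, t, s). T - t)") auto

declare value_fn.simps [simp del]

lemma value_fn_T: "value_fn T E Pin Pout C A T s = 0"
  by (simp add: value_fn.simps)

lemma value_fn_step:
  assumes "t \<in> {1..T}"
  shows "value_fn T E Pin Pout C A (t - 1) s =
    (INF x \<in> feasible E Pin Pout t s. stage_objective C A (value_fn T E Pin Pout C A) t s x)"
proof -
  have "t - 1 < T" "Suc (t - 1) = t"
    using assms by auto
  then show ?thesis
    unfolding stage_objective_def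
    by (subst value_fn.simps) (simp only: if_True)
qed

definition threshold_policy ::
  "(nat \<Rightarrow> real) \<Rightarrow> (nat \<Rightarrow> real) \<Rightarrow> (nat \<Rightarrow> real) \<Rightarrow> (nat \<Rightarrow> real) \<Rightarrow> nat \<Rightarrow> real \<Rightarrow> real" where
  "threshold_policy Pin Pout sb ss t s =
    (if s < sb t then min (sb t - s) (Pin t)
     else if s \<le> ss t then 0
     else max (ss t - s) (- Pout t))"

end

theory Submission
  imports Defs
begin

text \<open>
  Write \<open>g\<^sub>t = A\<^sub>t + V\<^sub>t\<close>. Everything rests on the convexity of \<open>V\<^sub>t\<close>, which is proved backwards in
  time: since \<open>c\<^sup>s \<le> c\<^sup>b\<close>, the cost \<open>C\<^sub>t\<close> is the maximum of two linear functions, so the stage objective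
  is jointly convex in the current level and the change of level; minimising a jointly convex function
  over one of its variables leaves a convex function of the other (\<open>epi_convex_on_INF\<close>,
  \<open>epi_convex_on_value_fn\<close>).

  Given convexity, consider the level \<open>y = s + x\<close> reached from \<open>s\<close>. Up to a constant the objective is
  \<open>c\<^sup>b y + g\<^sub>t y\<close> when buying and \<open>c\<^sup>s y + g\<^sub>t y\<close> when selling, and it always dominates both expressions,
  each shifted by its own constant. A convex function does not decrease as one moves away from its minimiser
  (\<open>epi_convex_on_between_le\<close>). Hence below \<open>s\<^sup>b\<close> one buys until \<open>s\<^sup>b\<close> or the rate limit is reached,
  above \<open>s\<^sup>s\<close> one sells until \<open>s\<^sup>s\<close> or the rate limit is reached, and in between neither buying nor
  selling improves on doing nothing. The order \<open>s\<^sup>b \<le> s\<^sup>s\<close> comes from comparing the two minimisers with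
  each other; this is the one place where the infinite values of \<open>V\<^sub>t\<close> could interfere, and it needs
  \<open>V\<^sub>t > -\<infinity>\<close> everywhere and \<open>V\<^sub>t < \<infinity>\<close> somewhere in \<open>[0, E\<^sub>t]\<close>, namely at \<open>0\<close>.
\<close>

section \<open>Convexity of functions with infinite values\<close>

text \<open>
  Convexity is expressed through the epigraph over real heights, which avoids all arithmetic with
  infinite values: no product \<open>0 \<cdot> \<infinity>\<close> and no sum \<open>\<infinity> - \<infinity>\<close> needs an interpretation.
\<close>

definition epi_convex_on :: "'a::real_vector set \<Rightarrow> ('a \<Rightarrow> ereal) \<Rightarrow> bool" where
  "epi_convex_on S f \<longleftrightarrow> convex {(x, r). x \<in> S \<and> f x \<le> ereal r}"

lemma epi_convex_onI:
  assumes "convex S"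
    and "\<And>x y p q u v. x \<in> S \<Longrightarrow> y \<in> S \<Longrightarrow> f x \<le> ereal p \<Longrightarrow> f y \<le> ereal q \<Longrightarrow> 0 \<le> u \<Longrightarrow> 0 \<le> v \<Longrightarrow>
      u + v = 1 \<Longrightarrow> f (u *\<^sub>R x + v *\<^sub>R y) \<le> ereal (u * p + v * q)"
  shows "epi_convex_on S f"
  unfolding epi_convex_on_def convex_def
  using assms by (auto simp: convex_def)

lemma epi_convex_onD:
  assumes "epi_convex_on S f" "x \<in> S" "y \<in> S" "f x \<le> ereal p" "f y \<le> ereal q" "0 \<le> u" "0 \<le> v" "u + v = 1"
  shows "f (u *\<^sub>R x + v *\<^sub>R y) \<le> ereal (u * p + v * q)"
proof -
  have "u *\<^sub>R (x, p) + v *\<^sub>R (y, q) \<in> {(x, r). x \<in> S \<and> f x \<le> ereal r}"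
    by (rule convexD[OF assms(1)[unfolded epi_convex_on_def]]) (use assms in auto)
  then show ?thesis by simp
qed

lemma ereal_add_le_ereal_iff: "ereal a + f \<le> ereal r \<longleftrightarrow> f \<le> ereal (r - a)"
  by (cases f) auto

lemma epi_convex_on_add_convex_on:
  assumes h: "convex_on S h" and f: "epi_convex_on S f"
  shows "epi_convex_on S (\<lambda>x. ereal (h x) + f x)"
proof (rule epi_convex_onI)
  show "convex S" using h by (rule convex_on_imp_convex)
next
  fix x y p q and u v :: real
  assume xy: "x \<in> S" "y \<in> S" and p: "ereal (h x) + f x \<le> ereal p" and q: "ereal (h y) + f y \<le> ereal q"
    and uv: "0 \<le> u" "0 \<le> v" "u + v = 1"
  have "f (u *\<^sub>R x + v *\<^sub>R y) \<le> ereal (u * (p - h x) + v * (q - h y))"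
    using epi_convex_onD[OF f xy _ _ uv] p q by (simp add: ereal_add_le_ereal_iff)
  moreover have "h (u *\<^sub>R x + v *\<^sub>R y) \<le> u * h x + v * h y"
    using h xy uv by (auto simp: convex_on_def)
  ultimately show "ereal (h (u *\<^sub>R x + v *\<^sub>R y)) + f (u *\<^sub>R x + v *\<^sub>R y) \<le> ereal (u * p + v * q)"
    unfolding ereal_add_le_ereal_iff
    by (elim order_trans) (simp add: algebra_simps)
qed

lemma epi_convex_on_compose_linear:
  assumes f: "epi_convex_on S f" and l: "linear l" and D: "convex D" "l ` D \<subseteq> S"
  shows "epi_convex_on D (\<lambda>x. f (l x))"
proof (rule epi_convex_onI[OF D(1)])
  fix x y p q and u v :: real
  assume "x \<in> D" "y \<in> D" "f (l x) \<le> ereal p" "f (l y) \<le> ereal q" and uv: "0 \<le> u" "0 \<le> v" "u + v = 1"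
  then have "f (u *\<^sub>R l x + v *\<^sub>R l y) \<le> ereal (u * p + v * q)"
    using D(2) by (intro epi_convex_onD[OF f _ _ _ _ uv]) auto
  then show "f (l (u *\<^sub>R x + v *\<^sub>R y)) \<le> ereal (u * p + v * q)"
    using l by (simp add: linear_add linear_scale)
qed

text \<open>
  Combine optimal choices for two parameters with the weights used to combine the parameters: the result
  is an admissible choice for the combined parameter, optimal or not, and its value is bounded by joint
  convexity. Attainment makes the two optimal choices available.
\<close>

lemma epi_convex_on_INF:
  assumes S: "convex S" and F: "epi_convex_on D (\<lambda>(s, x). F s x)" and D: "convex D"
    and attained: "\<And>s. s \<in> S \<Longrightarrow> {x. (s, x) \<in> D} \<noteq> {} \<Longrightarrow> \<exists>x. is_arg_min (F s) (\<lambda>x. (s, x) \<in> D) x"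
  shows "epi_convex_on S (\<lambda>s. INF x \<in> {x. (s, x) \<in> D}. F s x)"
proof (rule epi_convex_onI[OF S])
  have attained_le: "\<exists>x. (s, x) \<in> D \<and> F s x \<le> ereal r"
    if s: "s \<in> S" and r: "(INF x \<in> {x. (s, x) \<in> D}. F s x) \<le> ereal r" for s r
  proof -
    have "{x. (s, x) \<in> D} \<noteq> {}"
      using r by (intro notI) (simp add: top_ereal_def)
    then obtain x where "is_arg_min (F s) (\<lambda>x. (s, x) \<in> D) x"
      using attained[OF s] by blast
    then have x: "(s, x) \<in> D" "\<And>y. (s, y) \<in> D \<Longrightarrow> F s x \<le> F s y"
      by (auto simp: is_arg_min_linorder)
    then have "F s x \<le> (INF x \<in> {x. (s, x) \<in> D}. F s x)"
      by (intro INF_greatest) auto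
    with r x(1) show ?thesis by (meson order_trans)
  qed
  fix a b p q and u v :: real
  assume ab: "a \<in> S" "b \<in> S" and p: "(INF x \<in> {x. (a, x) \<in> D}. F a x) \<le> ereal p"
    and q: "(INF x \<in> {x. (b, x) \<in> D}. F b x) \<le> ereal q" and uv: "0 \<le> u" "0 \<le> v" "u + v = 1"
  obtain x y where x: "(a, x) \<in> D" "F a x \<le> ereal p" and y: "(b, y) \<in> D" "F b y \<le> ereal q"
    using attained_le[OF ab(1) p] attained_le[OF ab(2) q] by blast
  have "F (u *\<^sub>R a + v *\<^sub>R b) (u *\<^sub>R x + v *\<^sub>R y) \<le> ereal (u * p + v * q)"
    using epi_convex_onD[OF F x(1) y(1) _ _ uv, of p q] x(2) y(2) by simp
  moreover have "(u *\<^sub>R a + v *\<^sub>R b, u *\<^sub>R x + v *\<^sub>R y) \<in> D"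
    using convexD[OF D x(1) y(1) uv] by simp
  ultimately show "(INF x \<in> {x. (u *\<^sub>R a + v *\<^sub>R b, x) \<in> D}. F (u *\<^sub>R a + v *\<^sub>R b) x) \<le> ereal (u * p + v * q)"
    by (auto intro: INF_lower2)
qed

text \<open>
  Every real bound for \<open>f z\<close> is also a bound for the smaller value \<open>f m\<close>, hence for \<open>f\<close> on the whole
  segment between \<open>m\<close> and \<open>z\<close>.
\<close>

lemma epi_convex_on_between_le:
  assumes f: "epi_convex_on S f" and "m \<in> S" "z \<in> S" "f m \<le> f z" "y \<in> closed_segment m z"
  shows "f y \<le> f z"
proof (rule ereal_le_real)
  fix r assume "f z \<le> ereal r"
  moreover obtain u where "0 \<le> u" "u \<le> 1" "y = (1 - u) *\<^sub>R m + u *\<^sub>R z"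
    using assms(5) by (auto simp: closed_segment_def)
  ultimately show "f y \<le> ereal r"
    using epi_convex_onD[OF f assms(2,3), of r r "1 - u" u] assms(4) by (auto simp flip: distrib_right)
qed

section \<open>The value functions\<close>

definition transitions :: "real \<Rightarrow> real \<Rightarrow> real \<Rightarrow> (real \<times> real) set" where
  "transitions e pin pout = {(s, x). - pout \<le> x \<and> x \<le> pin \<and> 0 \<le> s + x \<and> s + x \<le> e}"

lemma feasible_eq_transitions: "feasible E Pin Pout t s = {x. (s, x) \<in> transitions (E t) (Pin t) (Pout t)}"
  by (auto simp: feasible_def rate_set_def transitions_def)

text \<open>
  Joint convexity of \<open>transitions\<close> and of the stage objective is inherited along the two linear maps
  \<open>(s, x) \<mapsto> x\<close> and \<open>(s, x) \<mapsto> s + x\<close>.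
\<close>

lemma linear_resulting_level: "linear (\<lambda>(s :: real, x). s + x)"
  by (rule linearI) (auto simp: algebra_simps)

lemma convex_transitions: "convex (transitions e pin pout)"
proof -
  have "transitions e pin pout = snd -` {- pout .. pin} \<inter> (\<lambda>(s, x). s + x) -` {0 .. e}"
    by (auto simp: transitions_def)
  then show ?thesis
    by (simp add: convex_Int convex_linear_vimage linear_snd linear_resulting_level)
qed

lemma convex_on_compose_linear_on:
  assumes h: "convex_on S h" and l: "linear l" and D: "convex D" "l ` D \<subseteq> S"
  shows "convex_on D (\<lambda>x. h (l x))"
proof (rule convex_onI[OF _ D(1)])
  fix t :: real and x y
  assume t: "0 < t" "t < 1" and "x \<in> D" "y \<in> D"
  then have "h ((1 - t) *\<^sub>R l x + t *\<^sub>R l y) \<le> (1 - t) * h (l x) + t * h (l y)"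
    using D(2) by (intro convex_onD[OF h]) auto
  then show "h (l ((1 - t) *\<^sub>R x + t *\<^sub>R y)) \<le> (1 - t) * h (l x) + t * h (l y)"
    using l by (simp add: linear_add linear_scale)
qed

lemma epi_convex_on_stage:
  assumes c: "convex_on {- pout .. pin} c" and a: "convex_on {0 .. e} a" and w: "epi_convex_on {0..} w"
  shows "epi_convex_on (transitions e pin pout) (\<lambda>(s, x). ereal (c x + a (s + x)) + w (s + x))"
proof -
  let ?D = "transitions e pin pout" and ?level = "\<lambda>(s :: real, x). s + x"
  have "convex_on ?D (\<lambda>p. c (snd p))"
    by (rule convex_on_compose_linear_on[OF c linear_snd convex_transitions]) (auto simp: transitions_def)
  moreover have "convex_on ?D (\<lambda>p. a (?level p))"
    by (rule convex_on_compose_linear_on[OF a linear_resulting_level convex_transitions])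
      (auto simp: transitions_def)
  ultimately have "convex_on ?D (\<lambda>p. c (snd p) + a (?level p))"
    by (rule convex_on_add)
  moreover have "epi_convex_on ?D (\<lambda>p. w (?level p))"
    by (rule epi_convex_on_compose_linear[OF w linear_resulting_level convex_transitions])
      (auto simp: transitions_def)
  ultimately show ?thesis
    by (drule_tac epi_convex_on_add_convex_on) (simp_all add: case_prod_beta')
qed

lemma convex_on_buy_sell_cost:
  fixes cb cs :: real
  assumes "cs \<le> cb" and X: "convex X"
    and cost: "\<And>x. x \<in> X \<Longrightarrow> c x = (if x \<ge> 0 then cb * x else cs * x)"
  shows "convex_on X c"
proof (rule convex_onI[OF _ X])
  have cost_max: "c x = max (cb * x) (cs * x)" if "x \<in> X" for x
    using \<open>cs \<le> cb\<close> cost[OF that]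
    by (auto simp: max_def mult_right_mono mult_right_mono_neg intro: antisym)
  fix t x y :: real
  assume t: "0 < t" "t < 1" and xy: "x \<in> X" "y \<in> X"
  have linear_le: "k * ((1 - t) *\<^sub>R x + t *\<^sub>R y) \<le> (1 - t) * c x + t * c y" if "k \<in> {cb, cs}" for k
  proof -
    have "(1 - t) * (k * x) + t * (k * y) \<le> (1 - t) * c x + t * c y"
      using that t xy by (intro add_mono mult_left_mono) (auto simp: cost_max)
    then show ?thesis by (simp add: algebra_simps)
  qed
  have "(1 - t) *\<^sub>R x + t *\<^sub>R y \<in> X"
    using X xy t by (intro convexD) auto
  then show "c ((1 - t) *\<^sub>R x + t *\<^sub>R y) \<le> (1 - t) * c x + t * c y"
    using linear_le[of cb] linear_le[of cs] by (subst cost_max) (auto intro: max.boundedI)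
qed

lemma value_fn_le_stage_objective:
  assumes "t \<in> {1..T}" "x \<in> feasible E Pin Pout t s"
  shows "value_fn T E Pin Pout C A (t - 1) s \<le> stage_objective C A (value_fn T E Pin Pout C A) t s x"
  using assms by (subst value_fn_step) (auto intro: INF_lower)

text \<open>Standing still at the empty store is always possible, and costs a finite amount in each period.\<close>

lemma value_fn_0_less_infinity:
  assumes E: "\<And>t. t \<in> {1..T} \<Longrightarrow> 0 \<le> E t"
    and P: "\<And>t. t \<in> {1..T} \<Longrightarrow> 0 \<le> Pin t \<and> 0 \<le> Pout t"
    and "t \<le> T"
  shows "value_fn T E Pin Pout C A t 0 < \<infinity>"
  using \<open>t \<le> T\<close>
proof (induction rule: inc_induct)
  case base
  then show ?case by (simp add: value_fn_T)
next
  case (step n)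
  have "0 \<in> feasible E Pin Pout (Suc n) 0"
    using E[of "Suc n"] P[of "Suc n"] step by (simp add: feasible_def rate_set_def)
  then have "value_fn T E Pin Pout C A n 0 \<le> stage_objective C A (value_fn T E Pin Pout C A) (Suc n) 0 0"
    using value_fn_le_stage_objective[of "Suc n" T 0 E Pin Pout 0 C A] step by simp
  also have "\<dots> < \<infinity>"
    using step by (simp add: stage_objective_def)
  finally show ?case .
qed

text \<open>
  An attained minimum is one of the values of the objective, so \<open>-\<infinity>\<close> would have to enter through the
  final value function, which is \<open>0\<close>.
\<close>

lemma value_fn_greater_minus_infinity:
  assumes attained: "\<And>t s. t \<in> {1..T} \<Longrightarrow> s \<ge> 0 \<Longrightarrow> feasible E Pin Pout t s \<noteq> {} \<Longrightarrow>
      \<exists>x. is_arg_min (stage_objective C A (value_fn T E Pin Pout C A) t s)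
        (\<lambda>x. x \<in> feasible E Pin Pout t s) x"
    and "t \<le> T" "0 \<le> s"
  shows "- \<infinity> < value_fn T E Pin Pout C A t s"
  using \<open>t \<le> T\<close> \<open>0 \<le> s\<close>
proof (induction arbitrary: s rule: inc_induct)
  case base
  then show ?case by (simp add: value_fn_T)
next
  case (step n)
  let ?obj = "stage_objective C A (value_fn T E Pin Pout C A) (Suc n) s"
    and ?X = "feasible E Pin Pout (Suc n) s"
  have V: "value_fn T E Pin Pout C A n s = (INF x \<in> ?X. ?obj x)"
    using value_fn_step[of "Suc n" T E Pin Pout C A s] step by simp
  show ?case
  proof (cases "?X = {}")
    case True
    then show ?thesis by (simp add: V top_ereal_def)
  next
    case False
    then obtain x where x: "x \<in> ?X" "\<And>y. y \<in> ?X \<Longrightarrow> ?obj x \<le> ?obj y"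
      using attained[of "Suc n" s] step by (auto simp: is_arg_min_linorder)
    then have "- \<infinity> < value_fn T E Pin Pout C A (Suc n) (s + x)"
      using step.IH by (auto simp: feasible_def)
    then have "- \<infinity> < ?obj x"
      by (auto simp: stage_objective_def)
    also have "?obj x \<le> value_fn T E Pin Pout C A n s"
      unfolding V using x by (intro INF_greatest)
    finally show ?thesis .
  qed
qed

lemma epi_convex_on_value_fn:
  assumes attained: "\<And>t s. t \<in> {1..T} \<Longrightarrow> s \<ge> 0 \<Longrightarrow> feasible E Pin Pout t s \<noteq> {} \<Longrightarrow>
      \<exists>x. is_arg_min (stage_objective C A (value_fn T E Pin Pout C A) t s)
        (\<lambda>x. x \<in> feasible E Pin Pout t s) x"
    and C: "\<And>t. t \<in> {1..T} \<Longrightarrow> convex_on (rate_set Pin Pout t) (C t)"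
    and A: "\<And>t. t \<in> {1..T} \<Longrightarrow> convex_on {0..E t} (A t)"
    and "t \<le> T"
  shows "epi_convex_on {0..} (value_fn T E Pin Pout C A t)"
  using \<open>t \<le> T\<close>
proof (induction rule: inc_induct)
  case base
  show ?case by (rule epi_convex_onI) (auto simp: value_fn_T)
next
  case (step n)
  let ?D = "transitions (E (Suc n)) (Pin (Suc n)) (Pout (Suc n))"
    and ?obj = "stage_objective C A (value_fn T E Pin Pout C A) (Suc n)"
  have n: "Suc n \<in> {1..T}" using step by simp
  have "epi_convex_on ?D (\<lambda>(s, x). ?obj s x)"
    unfolding stage_objective_def
    by (rule epi_convex_on_stage) (use C[OF n] A[OF n] step.IH in \<open>simp_all add: rate_set_def\<close>)
  then have "epi_convex_on {0..} (\<lambda>s. INF x \<in> {x. (s, x) \<in> ?D}. ?obj s x)"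
    by (rule epi_convex_on_INF[rotated])
      (use attained[OF n] convex_transitions in \<open>simp_all add: feasible_eq_transitions\<close>)
  moreover have "value_fn T E Pin Pout C A n = (\<lambda>s. INF x \<in> {x. (s, x) \<in> ?D}. ?obj s x)"
    using value_fn_step[OF n, of E Pin Pout C A] by (simp add: feasible_eq_transitions fun_eq_iff)
  ultimately show ?case by simp
qed

section \<open>The threshold policy\<close>

text \<open>
  Raising the price of stored goods cannot raise the preferred level: adding the two optimality
  inequalities gives \<open>(c' - c) * (y' - y) \<le> 0\<close>. The cancellation of \<open>g y\<close> and \<open>g y'\<close> is legitimate
  because a minimiser of a function that is somewhere below \<open>\<infinity>\<close> has a finite value.
\<close>

lemma arg_min_antimono_price:
  fixes g :: "real \<Rightarrow> ereal" and h :: "real \<Rightarrow> real"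
  assumes "c < c'"
    and y': "is_arg_min (\<lambda>s. ereal (c' * s + h s) + g s) (\<lambda>s. s \<in> S) y'"
    and y: "is_arg_min (\<lambda>s. ereal (c * s + h s) + g s) (\<lambda>s. s \<in> S) y"
    and g: "\<And>s. s \<in> S \<Longrightarrow> - \<infinity> < g s" and z: "z \<in> S" "g z < \<infinity>"
  shows "y' \<le> y"
proof -
  have in_S: "y \<in> S" "y' \<in> S"
    using y y' by (auto simp: is_arg_min_linorder)
  have le: "ereal (c' * y' + h y') + g y' \<le> ereal (c' * s + h s) + g s"
      "ereal (c * y + h y) + g y \<le> ereal (c * s + h s) + g s" if "s \<in> S" for s
    using y y' that by (auto simp: is_arg_min_linorder)
  obtain p p' where p: "g y = ereal p" "g y' = ereal p'"
    using le[OF z(1)] g[OF in_S(1)] g[OF in_S(2)] g[OF z(1)] z(2)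
    by (cases "g y"; cases "g y'"; cases "g z") auto
  have "c' * y' + h y' + p' \<le> c' * y + h y + p" "c * y + h y + p \<le> c * y' + h y' + p'"
    using le(1)[OF in_S(1)] le(2)[OF in_S(2)] by (simp_all add: p)
  then have "(c' - c) * (y' - y) \<le> 0"
    by (simp add: algebra_simps)
  with \<open>c < c'\<close> show ?thesis
    by (simp add: mult_le_0_iff)
qed

text \<open>
  The argument for a single period, with an arbitrary convex continuation value. The initial level may
  exceed the capacity \<open>E\<^sub>t\<close>; that some change is feasible then ensures that selling at the full rate
  brings the level down to the capacity.
\<close>

lemma threshold_policy_is_arg_min:
  fixes t :: nat and s :: real and A :: "nat \<Rightarrow> real \<Rightarrow> real" and V :: "nat \<Rightarrow> real \<Rightarrow> ereal"
  defines "level_cost \<equiv> \<lambda>c y. ereal (c * y + A t y) + V t y"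
  assumes cost: "\<And>x. x \<in> rate_set Pin Pout t \<Longrightarrow> C t x = (if x \<ge> 0 then cb * x else cs * x)"
    and le: "cs \<le> cb" "sb t \<le> ss t" and rates: "0 \<le> Pin t" "0 \<le> Pout t"
    and convex: "\<And>c. epi_convex_on {0..E t} (level_cost c)"
    and sb: "is_arg_min (level_cost cb) (\<lambda>y. y \<in> {0..E t}) (sb t)"
    and ss: "is_arg_min (level_cost cs) (\<lambda>y. y \<in> {0..E t}) (ss t)"
    and s: "0 \<le> s" "feasible E Pin Pout t s \<noteq> {}"
  shows "is_arg_min (stage_objective C A V t s) (\<lambda>x. x \<in> feasible E Pin Pout t s)
    (threshold_policy Pin Pout sb ss t s)"
proof -
  let ?obj = "stage_objective C A V t s" and ?X = "feasible E Pin Pout t s"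
    and ?p = "threshold_policy Pin Pout sb ss t s"
  have sb_in: "sb t \<in> {0..E t}" and sb_le: "\<And>y. y \<in> {0..E t} \<Longrightarrow> level_cost cb (sb t) \<le> level_cost cb y"
    using sb by (auto simp: is_arg_min_linorder)
  have ss_in: "ss t \<in> {0..E t}" and ss_le: "\<And>y. y \<in> {0..E t} \<Longrightarrow> level_cost cs (ss t) \<le> level_cost cs y"
    using ss by (auto simp: is_arg_min_linorder)
  have shift: "ereal (c * x + A t (s + x)) + V t (s + x) = level_cost c (s + x) + ereal (- (c * s))" for c x
    unfolding level_cost_def by (cases "V t (s + x)") (auto simp: algebra_simps)
  have obj_buy: "?obj x = level_cost cb (s + x) + ereal (- (cb * s))" if "x \<in> ?X" "0 \<le> x" for x
    unfolding shift[symmetric] using that cost[of x] by (simp add: stage_objective_def feasible_def)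
  have obj_sell: "?obj x = level_cost cs (s + x) + ereal (- (cs * s))" if "x \<in> ?X" "x \<le> 0" for x
    unfolding shift[symmetric] using that cost[of x]
    by (cases "x = 0") (simp_all add: stage_objective_def feasible_def)
  have obj_ge: "level_cost c (s + x) + ereal (- (c * s)) \<le> ?obj x" if "x \<in> ?X" "c \<in> {cb, cs}" for c x
  proof -
    have "c * x \<le> C t x"
      using that cost[of x] le(1) by (auto simp: feasible_def mult_right_mono mult_right_mono_neg)
    then show ?thesis
      unfolding shift[symmetric] stage_objective_def by (intro add_right_mono) simp
  qed
  have below: "level_cost cb y \<le> level_cost cb z"
    if "z \<in> {0..E t}" "y \<in> closed_segment (sb t) z" for y z
    using epi_convex_on_between_le[OF convex sb_in that(1) sb_le[OF that(1)] that(2)] .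
  have above: "level_cost cs y \<le> level_cost cs z"
    if "z \<in> {0..E t}" "y \<in> closed_segment (ss t) z" for y z
    using epi_convex_on_between_le[OF convex ss_in that(1) ss_le[OF that(1)] that(2)] .
  have p: "?p \<in> ?X"
    using s rates le(2) sb_in ss_in
    by (auto simp: threshold_policy_def feasible_def rate_set_def min_def max_def)
  moreover have "?obj ?p \<le> ?obj x" if x: "x \<in> ?X" for x
  proof -
    have z: "s + x \<in> {0..E t}" and x_le: "- Pout t \<le> x" "x \<le> Pin t"
      using x by (auto simp: feasible_def rate_set_def)
    \<comment> \<open>It suffices to compare levels at the price that the policy itself faces: for any other change
      that price, buying or selling, gives a lower bound for the cost.\<close>
    have buy: ?thesis if "0 \<le> ?p" "level_cost cb (s + ?p) \<le> level_cost cb (s + x)"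
      unfolding obj_buy[OF p that(1)]
      using that(2) obj_ge[OF x, of cb] by (meson add_right_mono insertI1 order_trans)
    have sell: ?thesis if "?p \<le> 0" "level_cost cs (s + ?p) \<le> level_cost cs (s + x)"
      unfolding obj_sell[OF p that(1)]
      using that(2) obj_ge[OF x, of cs] by (meson add_right_mono insertI1 insertI2 order_trans)
    consider "s < sb t" | "sb t \<le> s" "s \<le> ss t" | "ss t < s" "sb t \<le> s"
      using le(2) by linarith
    then show ?thesis
    proof cases
      case 1
      then have p_eq: "?p = min (sb t - s) (Pin t)"
        by (simp add: threshold_policy_def)
      show ?thesis
      proof (rule buy)
        show "0 \<le> ?p" using 1 rates by (simp add: p_eq)
        show "level_cost cb (s + ?p) \<le> level_cost cb (s + x)"
        proof (cases "sb t - s \<le> Pin t")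
          case True
          then show ?thesis using sb_le[OF z] by (simp add: p_eq)
        next
          case False
          then show ?thesis
            using x_le by (intro below z) (auto simp: p_eq closed_segment_eq_real_ivl)
        qed
      qed
    next
      case 2
      then have p_eq: "?p = 0"
        by (simp add: threshold_policy_def)
      show ?thesis
      proof (cases "0 \<le> x")
        case True
        then show ?thesis
          using 2 by (intro buy below z) (auto simp: p_eq closed_segment_eq_real_ivl)
      next
        case False
        then show ?thesis
          using 2 by (intro sell above z) (auto simp: p_eq closed_segment_eq_real_ivl)
      qed
    next
      case 3
      then have p_eq: "?p = max (ss t - s) (- Pout t)"
        by (simp add: threshold_policy_def)
      show ?thesis
      proof (rule sell)
        show "?p \<le> 0" using 3 rates by (simp add: p_eq)
        show "level_cost cs (s + ?p) \<le> level_cost cs (s + x)"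
        proof (cases "- Pout t \<le> ss t - s")
          case True
          then show ?thesis using ss_le[OF z] by (simp add: p_eq)
        next
          case False
          then show ?thesis
            using x_le by (intro above z) (auto simp: p_eq closed_segment_eq_real_ivl)
        qed
      qed
    qed
  qed
  ultimately show ?thesis by (simp add: is_arg_min_linorder)
qed

theorem proposition3:
  fixes T :: nat
    and E Pin Pout cb cs sb ss :: "nat \<Rightarrow> real"
    and C A :: "nat \<Rightarrow> real \<Rightarrow> real"
  defines "V \<equiv> value_fn T E Pin Pout C A"
  assumes E_pos: "\<And>t. t \<in> {1..T} \<Longrightarrow> E t > 0"
    and Pin_nonneg: "\<And>t. t \<in> {1..T} \<Longrightarrow> Pin t \<ge> 0"
    and Pout_nonneg: "\<And>t. t \<in> {1..T} \<Longrightarrow> Pout t \<ge> 0"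
    and min_attained: "\<And>t s. t \<in> {1..T} \<Longrightarrow> s \<ge> 0 \<Longrightarrow> feasible E Pin Pout t s \<noteq> {} \<Longrightarrow>
      \<exists>x. is_arg_min (stage_objective C A V t s) (\<lambda>x. x \<in> feasible E Pin Pout t s) x"
    and cost: "\<And>t x. t \<in> {1..T} \<Longrightarrow> x \<in> rate_set Pin Pout t \<Longrightarrow>
      C t x = (if x \<ge> 0 then cb t * x else cs t * x)"
    and cs_le_cb: "\<And>t. t \<in> {1..T} \<Longrightarrow> cs t \<le> cb t"
    and A_convex: "\<And>t. t \<in> {1..T} \<Longrightarrow> convex_on {0..E t} (A t)"
    and sb: "\<And>t. t \<in> {1..T} \<Longrightarrow>
      is_arg_min (\<lambda>s. ereal (cb t * s + A t s) + V t s) (\<lambda>s. s \<in> {0..E t}) (sb t)"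
    and ss: "\<And>t. t \<in> {1..T} \<Longrightarrow>
      is_arg_min (\<lambda>s. ereal (cs t * s + A t s) + V t s) (\<lambda>s. s \<in> {0..E t}) (ss t)"
    and tie_choice: "\<And>t. t \<in> {1..T} \<Longrightarrow> cs t = cb t \<Longrightarrow> sb t \<le> ss t"
  shows "\<forall>t \<in> {1..T}. sb t \<le> ss t \<and>
    (\<forall>s \<ge> 0. V (t - 1) s < \<infinity> \<longrightarrow>
      is_arg_min (stage_objective C A V t s) (\<lambda>x. x \<in> feasible E Pin Pout t s)
        (threshold_policy Pin Pout sb ss t s))"
proof (intro ballI conjI allI impI)
  fix t assume t: "t \<in> {1..T}"
  then have t_le: "t \<le> T" by simp
  have P: "0 \<le> Pin t \<and> 0 \<le> Pout t" if "t \<in> {1..T}" for t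
    using Pin_nonneg Pout_nonneg that by blast
  have attained: "\<exists>x. is_arg_min (stage_objective C A (value_fn T E Pin Pout C A) t s)
      (\<lambda>x. x \<in> feasible E Pin Pout t s) x"
    if "t \<in> {1..T}" "s \<ge> 0" "feasible E Pin Pout t s \<noteq> {}" for t s
    using min_attained[OF that] unfolding V_def .
  show sb_le_ss: "sb t \<le> ss t"
  proof (cases "cs t = cb t")
    case True
    then show ?thesis using tie_choice t by blast
  next
    case False
    then have price_less: "cs t < cb t" using cs_le_cb[OF t] by simp
    have "- \<infinity> < V t s" if "s \<in> {0..E t}" for s
      unfolding V_def using value_fn_greater_minus_infinity[OF attained t_le] that by simp
    moreover have "V t 0 < \<infinity>"
      unfolding V_def using value_fn_0_less_infinity[OF _ P t_le, of E] E_pos by (simp add: less_imp_le)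
    ultimately show ?thesis
      using E_pos[OF t] by (intro arg_min_antimono_price[OF price_less sb[OF t] ss[OF t], of 0]) auto
  qed
  fix s :: real assume s: "0 \<le> s" and finite: "V (t - 1) s < \<infinity>"
  have "convex_on (rate_set Pin Pout t) (C t)" if t: "t \<in> {1..T}" for t
    by (rule convex_on_buy_sell_cost[OF cs_le_cb[OF t] _ cost[OF t]]) (simp add: rate_set_def)
  then have "epi_convex_on {0..} (V t)"
    unfolding V_def using attained A_convex t_le by (intro epi_convex_on_value_fn)
  then have V_convex: "epi_convex_on {0..E t} (V t)"
    using epi_convex_on_compose_linear[OF _ linear_ident, of "{0..}" "V t" "{0..E t}"] by simp
  have "convex_on {0..E t} (\<lambda>y. c * y + A t y)" for c
    by (intro convex_on_add A_convex t convex_onI) (simp_all add: algebra_simps)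
  then have level_cost_convex: "epi_convex_on {0..E t} (\<lambda>y. ereal (c * y + A t y) + V t y)" for c
    using V_convex by (rule epi_convex_on_add_convex_on)
  have "feasible E Pin Pout t s \<noteq> {}"
  proof
    assume "feasible E Pin Pout t s = {}"
    with finite show False
      unfolding V_def value_fn_step[OF t] by (simp add: top_ereal_def)
  qed
  with s show "is_arg_min (stage_objective C A V t s) (\<lambda>x. x \<in> feasible E Pin Pout t s)
      (threshold_policy Pin Pout sb ss t s)"
    using cost[OF t] cs_le_cb[OF t] P[OF t] sb_le_ss level_cost_convex sb[OF t] ss[OF t]
    by (intro threshold_policy_is_arg_min) auto
qed

end
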